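(* For any connected graph $G$ with at least $3$ vertices, $0$, $1$ and $2$ are the smallest three distance Pareto eigenvalues of $G$; that is, $\mu_1(G)=0$, $\mu_2(G)=1$ and $\mu_3(G)=2$.
   Context: All graphs are finite, undirected, simple and connected. The distance matrix $\mathcal{D}(G)$ of a graph $G$ on vertices $1,\dots,n$ is the $n\times n$ matrix whose $(i,j)$ entry is the length of a shortest path from $i$ to $j$. A real number $\lambda$ is a Pareto eigenvalue of a real $n\times n$ matrix $A$ if there is a nonzero vector $\mathbf{x}\in\mathbb{R}^n$, $\mathbf{x}\ge 0$ (entrywise), with $A\mathbf{x}\ge\lambda\mathbf{x}$ (entrywise) and $\lambda=\frac{\mathbf{x}^TA\mathbf{x}}{\mathbf{x}^T\mathbf{x}}$. The distance Pareto eigenvalues of $G$ are the Pareto eigenvalues of $\mathcal{D}(G)$. $\mu_k(G)$ denotes the $k$-th smallest element of the set of distinct distance Pareto eigenvalues of $G$. *)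

theory Defs
  imports "HOL-Analysis.Analysis" "Graph_Theory.Graph_Theory"
begin

text \<open>
  A finite simple undirected graph is a \<^locale>\<open>graph\<close>: a finite symmetric digraph without
  loops and without parallel arcs, in which an undirected edge is a pair of opposite arcs.
  A path is an \<^const>\<open>pre_digraph.apath\<close> (a walk without repeated vertices), and its length is
  its number of arcs.  If there is no path from \<open>u\<close> to \<open>v\<close>, the value below is unspecified;
  it is only used for connected graphs.
\<close>

definition graph_dist :: "('a, 'b) pre_digraph \<Rightarrow> 'a \<Rightarrow> 'a \<Rightarrow> nat" where
  "graph_dist G u v = (LEAST k. \<exists>p. pre_digraph.apath G u p v \<and> length p = k)"

text \<open>
  This is the shortest-path distance of the library for unit arc weights.
\<close>

lemma (in fin_digraph) graph_dist_eq_mu: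
  assumes "u \<rightarrow>\<^sup>* v"
  shows "\<mu> (\<lambda>_. 1) u v = ereal (real (graph_dist G u v))"
proof -
  have cost: "awalk_cost (\<lambda>_. 1) p = real (length p)" for p
    by (induction p) auto
  obtain p where p: "apath u p v" "\<mu> (\<lambda>_. 1) u v = ereal (awalk_cost (\<lambda>_. 1) p)"
    using no_neg_cyc_reach_imp_path[OF assms, of "\<lambda>_. 1"] by (auto simp: cost)
  have "graph_dist G u v = length p"
    unfolding graph_dist_def
  proof (rule Least_equality)
    show "\<exists>q. apath u q v \<and> length q = length p"
      using p(1) by blast
  next
    fix k assume "\<exists>q. apath u q v \<and> length q = k"
    then obtain q where q: "apath u q v" "length q = k" by blast
    have "\<mu> (\<lambda>_. 1) u v \<le> ereal (awalk_cost (\<lambda>_. 1) q)"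
      using q(1) by (intro min_cost_le_walk_cost awalkI_apath)
    then show "length p \<le> k"
      using p(2) q(2) by (simp add: cost)
  qed
  then show ?thesis using p(2) by (simp add: cost)
qed

text \<open>
  The vertices index the rows and columns of the distance matrix, so its vertex set is the
  whole finite type \<open>'n\<close>.
\<close>

definition distance_matrix :: "('n::finite, 'b) pre_digraph \<Rightarrow> real ^ 'n ^ 'n" where
  "distance_matrix G = (\<chi> i j. real (graph_dist G i j))"

text \<open>The order on vectors is the entrywise one.\<close>

definition pareto_eigenvalue :: "real ^ 'n ^ 'n \<Rightarrow> real \<Rightarrow> bool" where
  "pareto_eigenvalue A lam \<longleftrightarrow>
     (\<exists>x :: real ^ 'n. x \<noteq> 0 \<and> 0 \<le> x \<and> lam *\<^sub>R x \<le> A *v x \<and>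
        lam = (x \<bullet> (A *v x)) / (x \<bullet> x))"

definition distance_pareto_eigenvalues :: "('n::finite, 'b) pre_digraph \<Rightarrow> real set" where
  "distance_pareto_eigenvalues G = {lam. pareto_eigenvalue (distance_matrix G) lam}"

text \<open>
  Counting starts at 1.  Finiteness is required explicitly because the cardinality of an
  infinite set is 0.
\<close>

definition is_kth_smallest :: "'a::linorder set \<Rightarrow> nat \<Rightarrow> 'a \<Rightarrow> bool" where
  "is_kth_smallest S k x \<longleftrightarrow>
     x \<in> S \<and> finite {y \<in> S. y < x} \<and> Suc (card {y \<in> S. y < x}) = k"

lemma is_kth_smallest_unique:
  assumes "is_kth_smallest S k x" "is_kth_smallest S k y"
  shows "x = y"
proof -
  have *: False if "is_kth_smallest S k a" "is_kth_smallest S k b" "a < b" for a b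
  proof -
    have "{y \<in> S. y < a} \<subset> {y \<in> S. y < b}"
      using that unfolding is_kth_smallest_def by (auto dest: less_trans)
    then have "card {y \<in> S. y < a} < card {y \<in> S. y < b}"
      using that(2) unfolding is_kth_smallest_def by (intro psubset_card_mono) auto
    then show False
      using that(1,2) unfolding is_kth_smallest_def by simp
  qed
  show ?thesis using *[of x y] *[of y x] assms by (cases x y rule: linorder_cases) auto
qed

definition distance_pareto_mu :: "nat \<Rightarrow> ('n::finite, 'b) pre_digraph \<Rightarrow> real" where
  "distance_pareto_mu k G = (THE lam. is_kth_smallest (distance_pareto_eigenvalues G) k lam)"

end

theory Submission
  imports Defs
begin

text \<open>
  Let \<open>x \<ge> 0\<close> be a Pareto eigenvector of the distance matrix \<open>A\<close> for \<open>lam\<close>, with support \<open>S\<close>.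
  Since \<open>A x - lam x\<close> is nonnegative and orthogonal to \<open>x\<close>, it vanishes on \<open>S\<close>.
  If \<open>S\<close> is a single vertex, \<open>lam = 0\<close>; if \<open>S = {i, j}\<close>, then \<open>lam\<close> is the distance from \<open>i\<close> to
  \<open>j\<close>; and if \<open>card S \<ge> 3\<close>, then, all off-diagonal entries being at least 1, summing the rows in
  \<open>S\<close> gives \<open>lam * sum x S \<ge> (card S - 1) * sum x S\<close>, so \<open>lam \<ge> 2\<close>.
  Conversely, the indicator vectors of a vertex, of an edge, and of either a pair of vertices at
  distance 2 or a triangle realise 0, 1 and 2.
\<close>

section \<open>Graph distance\<close>

text \<open>\<open>graph_dist\<close> minimises over paths only. Its agreement with
  \<open>\<mu>\<close> for unit weights, an infimum over all walks, extends the bound to walks with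
  repeated vertices.\<close>

lemma (in fin_digraph) graph_dist_le_length:
  assumes "awalk u p v"
  shows "graph_dist G u v \<le> length p"
proof -
  have "awalk_cost (\<lambda>_. 1) q = real (length q)" for q :: "'b list"
    by (induction q) auto
  moreover have "u \<rightarrow>\<^sup>* v"
    using assms by (rule reachable_awalkI)
  ultimately show ?thesis
    using min_cost_le_walk_cost[OF assms, of "\<lambda>_. 1"] by (simp add: graph_dist_eq_mu)
qed

lemma (in wf_digraph) obtain_shortest_apath:
  assumes "u \<rightarrow>\<^sup>* v"
  obtains p where "apath u p v" "length p = graph_dist G u v"
proof -
  from assms have "\<exists>k p. apath u p v \<and> length p = k"
    by (auto simp: reachable_apath)
  from LeastI_ex[OF this] show ?thesis
    using that unfolding graph_dist_def by blast
qed

lemma (in fin_digraph) graph_dist_self: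
  assumes "u \<in> verts G"
  shows "graph_dist G u u = 0"
  using graph_dist_le_length[of u "[]" u] assms by (simp add: awalk_Nil_iff)

lemma (in wf_digraph) graph_dist_pos:
  assumes "u \<rightarrow>\<^sup>* v" "u \<noteq> v"
  shows "1 \<le> graph_dist G u v"
proof -
  obtain p where "apath u p v" "length p = graph_dist G u v"
    using obtain_shortest_apath[OF assms(1)] .
  with assms(2) show ?thesis by (cases p) (auto simp: apath_Nil_iff)
qed

text \<open>Each arc is replaced by an opposite one and the order is reversed. Being a walk is
  enough for the symmetry of the distance, since walk lengths already bound
  \<open>graph_dist\<close>.\<close>

lemma (in sym_digraph) awalk_reverse:
  assumes "awalk u p v"
  shows "\<exists>q. awalk v q u \<and> length q = length p"
  using assms
proof (induction p arbitrary: u)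
  case Nil
  then show ?case by (auto simp: awalk_Nil_iff intro!: exI[of _ "[]"])
next
  case (Cons e p)
  then have e: "e \<in> arcs G" "u = tail G e" and "awalk (head G e) p v"
    by (auto simp: awalk_Cons_iff)
  with Cons.IH obtain q where q: "awalk v q (head G e)" "length q = length p"
    by blast
  obtain e' where "e' \<in> arcs G" "tail G e' = head G e" "head G e' = tail G e"
    using sym_arcs e(1) unfolding symmetric_conv by metis
  then have "awalk (head G e) [e'] u"
    using e by (auto simp: awalk_Cons_iff awalk_Nil_iff)
  with q show ?case
    by (intro exI[of _ "q @ [e']"]) (auto intro: awalk_appendI)
qed

lemma (in pseudo_graph) graph_dist_sym:
  assumes "u \<rightarrow>\<^sup>* v"
  shows "graph_dist G u v = graph_dist G v u"
proof -
  have *: "graph_dist G y x \<le> graph_dist G x y" if xy: "x \<rightarrow>\<^sup>* y" for x y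
  proof -
    obtain p where p: "apath x p y" "length p = graph_dist G x y"
      using obtain_shortest_apath[OF xy] .
    then obtain q where "awalk y q x" "length q = length p"
      using awalk_reverse awalkI_apath by blast
    with graph_dist_le_length[of y q x] p(2) show ?thesis by simp
  qed
  from *[OF assms] *[OF symmetric_reachable'[OF assms]] show ?thesis by simp
qed

lemma (in fin_digraph) graph_dist_eq_1_iff:
  assumes "u \<rightarrow>\<^sup>* v" "u \<noteq> v"
  shows "graph_dist G u v = 1 \<longleftrightarrow> u \<rightarrow>\<^bsub>G\<^esub> v"
proof
  assume "graph_dist G u v = 1"
  then obtain p where "apath u p v" "length p = 1"
    using obtain_shortest_apath[OF assms(1)] by metis
  then show "u \<rightarrow>\<^bsub>G\<^esub> v"
    by (auto simp: length_Suc_conv apath_Cons_iff apath_Nil_iff intro: in_arcs_imp_in_arcs_ends)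
next
  assume "u \<rightarrow>\<^bsub>G\<^esub> v"
  then obtain e where "e \<in> arcs G" "tail G e = u" "head G e = v"
    by (auto simp: arcs_ends_conv)
  then have "awalk u [e] v"
    by (auto simp: awalk_Cons_iff awalk_Nil_iff)
  from graph_dist_le_length[OF this] graph_dist_pos[OF assms] show "graph_dist G u v = 1"
    by simp
qed

text \<open>The walk through \<open>w\<close> bounds the distance by 2; distinctness excludes 0 and
  non-adjacency excludes 1.\<close>

lemma (in fin_digraph) graph_dist_eq_2:
  assumes "u \<rightarrow>\<^bsub>G\<^esub> w" "w \<rightarrow>\<^bsub>G\<^esub> v" "u \<noteq> v" "\<not> u \<rightarrow>\<^bsub>G\<^esub> v"
  shows "graph_dist G u v = 2"
proof -
  obtain e f where "e \<in> arcs G" "tail G e = u" "head G e = w"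
    "f \<in> arcs G" "tail G f = w" "head G f = v"
    using assms(1,2) by (auto simp: arcs_ends_conv)
  then have walk: "awalk u [e, f] v"
    by (auto simp: awalk_Cons_iff awalk_Nil_iff)
  then have reach: "u \<rightarrow>\<^sup>* v"
    by (rule reachable_awalkI)
  show ?thesis
    using graph_dist_le_length[OF walk] graph_dist_pos[OF reach assms(3)]
      graph_dist_eq_1_iff[OF reach assms(3)] assms(4) by simp
qed

text \<open>Follow a walk from \<open>u\<close>: the first time it leaves \<open>u\<close> and its
  out-neighbours, the vertex just before is some \<open>w\<close> adjacent from \<open>u\<close>,
  and the new vertex is \<open>x\<close>. This supplies a pair at distance 2.\<close>

lemma (in wf_digraph) reachable_not_adjacent_imp_induced_path:
  assumes "u \<rightarrow>\<^sup>* v" "u \<noteq> v" "\<not> u \<rightarrow>\<^bsub>G\<^esub> v"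
  obtains x w where "u \<rightarrow>\<^bsub>G\<^esub> w" "w \<rightarrow>\<^bsub>G\<^esub> x" "u \<noteq> x" "\<not> u \<rightarrow>\<^bsub>G\<^esub> x"
proof -
  from assms(1) have "v = u \<or> u \<rightarrow>\<^bsub>G\<^esub> v \<or> (\<exists>w x. u \<rightarrow>\<^bsub>G\<^esub> w \<and> w \<rightarrow>\<^bsub>G\<^esub> x \<and> u \<noteq> x \<and> \<not> u \<rightarrow>\<^bsub>G\<^esub> x)"
    by (induction rule: reachable_induct) blast+
  with assms(2,3) that show ?thesis by blast
qed

section \<open>Pareto eigenvalues\<close>

definition indicator_vec :: "'n set \<Rightarrow> real ^ 'n::finite" where
  "indicator_vec S = (\<chi> i. if i \<in> S then 1 else 0)"

text \<open>On \<open>S\<close> the constant row sums turn the inequality into an equality; off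
  \<open>S\<close> the left side is 0 and nonnegative entries suffice.\<close>

lemma pareto_eigenvalue_indicator_vec:
  fixes A :: "real ^ 'n ^ 'n"
  assumes "S \<noteq> {}"
    and nonneg: "\<And>i j. 0 \<le> A $ i $ j"
    and rows: "\<And>i. i \<in> S \<Longrightarrow> (\<Sum>j\<in>S. A $ i $ j) = lam"
  shows "pareto_eigenvalue A lam"
proof -
  define x :: "real ^ 'n" where "x = indicator_vec S"
  have x: "x $ i = (if i \<in> S then 1 else 0)" for i
    by (simp add: x_def indicator_vec_def)
  have Ax: "(A *v x) $ i = (\<Sum>j\<in>S. A $ i $ j)" for i
    by (simp add: matrix_vector_mult_def x if_distrib sum.If_cases)
  obtain i where "i \<in> S" using assms(1) by blast
  then have "x $ i \<noteq> 0 $ i" by (simp add: x)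
  then have "x \<noteq> 0" by metis
  moreover have "0 \<le> x"
    by (simp add: less_eq_vec_def x)
  moreover have "lam *\<^sub>R x \<le> A *v x"
    by (auto simp: less_eq_vec_def Ax x rows intro: sum_nonneg nonneg)
  moreover have "x \<bullet> (A *v x) = lam * (x \<bullet> x)"
    by (auto simp: inner_vec_def Ax x rows sum_distrib_left intro!: sum.cong)
  ultimately show ?thesis
    unfolding pareto_eigenvalue_def by (intro exI[of _ x]) simp
qed

lemma pareto_eigenvalue_support:
  fixes A :: "real ^ 'n ^ 'n"
  assumes "pareto_eigenvalue A lam"
  obtains x S where "S \<noteq> {}" "\<And>i. i \<in> S \<Longrightarrow> 0 < x i"
    "\<And>i. i \<in> S \<Longrightarrow> (\<Sum>j\<in>S. A $ i $ j * x j) = lam * x i"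
proof -
  obtain x where x: "x \<noteq> 0" "0 \<le> x" "lam *\<^sub>R x \<le> A *v x" "lam = (x \<bullet> (A *v x)) / (x \<bullet> x)"
    using assms unfolding pareto_eigenvalue_def by blast
  define S where "S = {i. x $ i \<noteq> 0}"
  have nonneg: "0 \<le> x $ i" for i
    using x(2) by (simp add: less_eq_vec_def)
  \<comment> \<open>Complementarity: the quotient formula for \<open>lam\<close> makes the residual
    orthogonal to \<open>x\<close>, and all terms of this inner product are nonnegative, so each one
    vanishes.\<close>
  have "x \<bullet> (A *v x - lam *\<^sub>R x) = 0"
    using x(1,4) by (simp add: inner_diff_right)
  then have "(\<Sum>i\<in>UNIV. x $ i * ((A *v x) $ i - lam * x $ i)) = 0"
    by (simp add: inner_vec_def)
  moreover have "0 \<le> x $ i * ((A *v x) $ i - lam * x $ i)" for i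
    using x(3) nonneg[of i] by (simp add: less_eq_vec_def)
  ultimately have "x $ i * ((A *v x) $ i - lam * x $ i) = 0" for i
    by (simp add: sum_nonneg_eq_0_iff)
  moreover have "(A *v x) $ i = (\<Sum>j\<in>S. A $ i $ j * x $ j)" for i
    unfolding matrix_vector_mult_def S_def by (auto intro: sum.mono_neutral_right)
  ultimately have "(\<Sum>j\<in>S. A $ i $ j * x $ j) = lam * x $ i" if "i \<in> S" for i
    using that by (metis (mono_tags, lifting) S_def mem_Collect_eq mult_eq_0_iff right_minus_eq)
  moreover have "0 < x $ i" if "i \<in> S" for i
    using that nonneg[of i] by (simp add: S_def)
  moreover have "S \<noteq> {}"
    using x(1) by (auto simp: S_def vec_eq_iff)
  ultimately show ?thesis using that[of S "\<lambda>i. x $ i"] by blast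
qed

lemma pareto_eigenvalue_cases:
  fixes A :: "real ^ 'n ^ 'n"
  assumes lam: "pareto_eigenvalue A lam"
    and diag: "\<And>i. A $ i $ i = 0"
    and sym: "\<And>i j. A $ i $ j = A $ j $ i"
    and off_diag: "\<And>i j. i \<noteq> j \<Longrightarrow> 1 \<le> A $ i $ j"
  obtains "lam = 0" | i j where "i \<noteq> j" "lam = A $ i $ j" | "2 \<le> lam"
proof -
  obtain x S where "S \<noteq> {}" and pos: "\<And>i. i \<in> S \<Longrightarrow> 0 < x i"
    and rows: "\<And>i. i \<in> S \<Longrightarrow> (\<Sum>j\<in>S. A $ i $ j * x j) = lam * x i"
    using pareto_eigenvalue_support[OF lam] by metis
  have "0 < card S" using \<open>S \<noteq> {}\<close> by (simp add: card_gt_0_iff)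
  then consider "card S = 1" | "card S = 2" | "3 \<le> card S" by linarith
  then show ?thesis
  proof cases
    case 1
    then obtain i where "S = {i}" by (auto simp: card_1_singleton_iff)
    with rows[of i] pos[of i] diag that(1) show ?thesis by simp
  next
    case 2
    then obtain i j where S: "S = {i, j}" "i \<noteq> j" by (auto simp: card_2_iff)
    define a where "a = A $ i $ j"
    have eqs: "a * x j = lam * x i" "a * x i = lam * x j"
      using rows[of i] rows[of j] S diag sym[of j i] by (simp_all add: a_def)
    \<comment> \<open>Adding the two equations leaves a positive factor to cancel, which excludes
      the other eigenvalue \<open>- a\<close> of the 2 by 2 block.\<close>
    then have "a * (x i + x j) = lam * (x i + x j)" by (simp add: algebra_simps)
    moreover have "0 < x i + x j" using S pos[of i] pos[of j] by simp
    ultimately have "lam = a" by simp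
    with that(2) S(2) show ?thesis by (simp add: a_def)
  next
    case 3
    define s where "s = sum x S"
    have "0 < s" unfolding s_def using \<open>S \<noteq> {}\<close> pos by (simp add: sum_pos)
    have row_ge: "s - x i \<le> lam * x i" if "i \<in> S" for i
    proof -
      have "s - x i = (\<Sum>j\<in>S - {i}. x j)"
        using that by (simp add: s_def sum_diff1)
      also have "\<dots> \<le> (\<Sum>j\<in>S - {i}. A $ i $ j * x j)"
      proof (rule sum_mono)
        fix j assume "j \<in> S - {i}"
        then have "0 < x j" "1 \<le> A $ i $ j"
          using pos off_diag by auto
        then show "x j \<le> A $ i $ j * x j" by simp
      qed
      also have "\<dots> = (\<Sum>j\<in>S. A $ i $ j * x j)"
        using that diag by (simp add: sum_diff1)
      finally show ?thesis using rows[OF that] by simp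
    qed
    \<comment> \<open>Each \<open>x i\<close> is missing only from the bound for its own row, so
      these bounds add up to \<open>card S - 1\<close> copies of \<open>s\<close>.\<close>
    have "2 * s \<le> (real (card S) - 1) * s"
      using 3 \<open>0 < s\<close> by (intro mult_right_mono) auto
    also have "\<dots> = (\<Sum>i\<in>S. s - x i)"
      by (simp add: sum_subtractf s_def algebra_simps)
    also have "\<dots> \<le> (\<Sum>i\<in>S. lam * x i)"
      using row_ge by (rule sum_mono)
    also have "\<dots> = lam * s"
      by (simp add: s_def sum_distrib_left)
    finally have "2 \<le> lam" using \<open>0 < s\<close> by simp
    with that(3) show ?thesis by blast
  qed
qed

lemma distance_pareto_mu_eqI:
  assumes "is_kth_smallest (distance_pareto_eigenvalues G) k lam"
  shows "distance_pareto_mu k G = lam"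
  unfolding distance_pareto_mu_def
  using assms by (rule the_equality) (rule is_kth_smallest_unique[OF _ assms])

theorem theorem4p1:
  fixes G :: "('n::finite, 'b) pre_digraph"
  assumes "graph G"
    and "verts G = UNIV"
    and "Digraph_Component.connected G"
    and "3 \<le> card (verts G)"
  shows "{0, 1, 2} \<subseteq> distance_pareto_eigenvalues G
    \<and> (\<forall>lam \<in> distance_pareto_eigenvalues G - {0, 1, 2}. 2 < lam)
    \<and> distance_pareto_mu 1 G = 0
    \<and> distance_pareto_mu 2 G = 1
    \<and> distance_pareto_mu 3 G = 2"
proof -
  interpret G: graph G by fact
  define A where "A = distance_matrix G"
  define E where "E = distance_pareto_eigenvalues G"
  have E: "lam \<in> E \<longleftrightarrow> pareto_eigenvalue A lam" for lam
    by (simp add: E_def A_def distance_pareto_eigenvalues_def)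
  have A: "A $ i $ j = real (graph_dist G i j)" for i j
    by (simp add: A_def distance_matrix_def)
  have reach: "i \<rightarrow>\<^sup>*\<^bsub>G\<^esub> j" for i j
    using G.symmetric_connected_imp_strongly_connected[OF G.sym_arcs assms(3)] assms(2)
    by (auto simp: strongly_connected_def)
  have diag: "A $ i $ i = 0" for i
    by (simp add: A G.graph_dist_self assms(2))
  have sym: "A $ i $ j = A $ j $ i" for i j
    by (simp add: A G.graph_dist_sym[OF reach])
  have off_diag: "1 \<le> A $ i $ j" if "i \<noteq> j" for i j
    using G.graph_dist_pos[OF reach that] by (simp add: A)
  \<comment> \<open>Within \<open>{i, j}\<close> each row has a zero and the distance, so both row
    sums equal the distance.\<close>
  have single_dist: "real (graph_dist G i j) \<in> E" if "i \<noteq> j" for i j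
    unfolding E A[symmetric]
    by (rule pareto_eigenvalue_indicator_vec[of "{i, j}"]) (use that diag sym in \<open>auto simp: A\<close>)

  obtain T where T: "card T = 3" "T \<subseteq> (UNIV :: 'n set)"
    using assms(2,4) by (metis obtain_subset_with_card_n)
  then obtain a b c :: 'n where abc: "a \<noteq> b" "a \<noteq> c" "b \<noteq> c"
    by (auto simp: card_3_iff)

  have "0 \<in> E"
    unfolding E by (rule pareto_eigenvalue_indicator_vec[of "{a}"]) (auto simp: diag A)
  moreover have "1 \<in> E"
  proof -
    \<comment> \<open>The first step of a walk from \<open>a\<close> to \<open>b\<close> gives a
      neighbour of \<open>a\<close>.\<close>
    obtain w where w: "a \<rightarrow>\<^bsub>G\<^esub> w"
      using reach[of a b] abc(1) by (cases rule: G.converse_reachable_cases) auto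
    then have "a \<noteq> w" using G.adj_not_same by blast
    with w have "graph_dist G a w = 1" using G.graph_dist_eq_1_iff[OF reach] by blast
    with single_dist[OF \<open>a \<noteq> w\<close>] show ?thesis by simp
  qed
  moreover have "2 \<in> E"
  \<comment> \<open>In a complete graph no two vertices are at distance 2, so a triangle, with all
    row sums 2, serves instead.\<close>
  proof (cases "\<forall>i j. i \<noteq> j \<longrightarrow> i \<rightarrow>\<^bsub>G\<^esub> j")
    case True
    then have "A $ i $ j = (if i = j then 0 else 1)" for i j
      using G.graph_dist_eq_1_iff[OF reach] diag by (simp add: A)
    with abc show ?thesis
      unfolding E by (intro pareto_eigenvalue_indicator_vec[of "{a, b, c}"]) auto
  next
    case False
    then obtain i j where "i \<noteq> j" "\<not> i \<rightarrow>\<^bsub>G\<^esub> j" by blast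
    then obtain w k where "i \<rightarrow>\<^bsub>G\<^esub> w" "w \<rightarrow>\<^bsub>G\<^esub> k" "i \<noteq> k" "\<not> i \<rightarrow>\<^bsub>G\<^esub> k"
      using G.reachable_not_adjacent_imp_induced_path[OF reach] by metis
    then show ?thesis
      using G.graph_dist_eq_2[of i w k] single_dist[of i k] by simp
  qed
  ultimately have mem: "0 \<in> E" "1 \<in> E" "2 \<in> E" by auto

  have small: "lam = 0 \<or> lam = 1 \<or> 2 \<le> lam" if "lam \<in> E" for lam
  proof -
    from that[unfolded E] diag sym off_diag
    consider "lam = 0" | i j where "i \<noteq> j" "lam = A $ i $ j" | "2 \<le> lam"
      by (rule pareto_eigenvalue_cases) auto
    then show ?thesis
    proof cases
      case (2 i j)
      then have "lam = real (graph_dist G i j)" "1 \<le> graph_dist G i j"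
        using G.graph_dist_pos[OF reach] by (simp_all add: A)
      \<comment> \<open>Distances are integers, so nothing lies strictly between 1 and 2.\<close>
      then show ?thesis by (cases "graph_dist G i j = 1") auto
    qed auto
  qed
  \<comment> \<open>Rank \<open>k\<close> means exactly \<open>k - 1\<close> elements strictly
    below, hence the sets of size 0, 1 and 2.\<close>
  have below: "{y \<in> E. y < 0} = {}" "{y \<in> E. y < 1} = {0}" "{y \<in> E. y < 2} = {0, 1}"
    using mem by (auto dest: small)
  have "is_kth_smallest E 1 0" "is_kth_smallest E 2 1" "is_kth_smallest E 3 2"
    unfolding is_kth_smallest_def using mem by (simp_all add: below)
  then have "distance_pareto_mu 1 G = 0" "distance_pareto_mu 2 G = 1" "distance_pareto_mu 3 G = 2"
    unfolding E_def by (simp_all only: distance_pareto_mu_eqI)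
  moreover have "\<forall>lam \<in> E - {0, 1, 2}. 2 < lam"
    by (auto dest: small)
  ultimately show ?thesis
    using mem by (simp add: E_def)
qed

end
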